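(* Let $A\in\mathbb{C}^{m\times n}$ have rank $a$, let $B\in\mathbb{C}^{p\times q}$ have rank $b$, let $C\in\mathbb{C}^{m\times q}$, and let $X_0\in\mathbb{C}^{n\times p}$ be any particular solution of the matrix equation $AXB=C$. Let $P_1,Q_1,P_2,Q_2$ and $\widehat{C}$ be the matrices described in the context, and let $$A^{(1)}=P_1\begin{bmatrix} I_a & X_1\\ X_2 & X_3\end{bmatrix}Q_1,\qquad B^{(1)}=P_2\begin{bmatrix} I_b & Y_1\\ Y_2 & Y_3\end{bmatrix}Q_2$$ be $\{1\}$-inverses of $A$ and $B$, where $X_1,X_2,X_3,Y_1,Y_2,Y_3$ are arbitrary complex matrices of suitable sizes. Then the general solution $$X=g(Y)=X_0+Y-A^{(1)}AYBB^{(1)},\qquad Y\in\mathbb{C}^{n\times p}\text{ arbitrary},$$ of the matrix equation $AXB=C$ is reproductive if and only if $$X_0=P_1\begin{bmatrix} C_1 & C_1Y_1\\ X_2C_1 & X_2C_1Y_1\end{bmatrix}Q_2,$$ where $C_1=[c_{i,j}]_{1\le i\le a,\,1\le j\le b}$ is the submatrix of $\widehat{C}$ formed by its first $a$ rows and first $b$ columns.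
   Context: A $\{1\}$-inverse of a matrix $M\in\mathbb{C}^{m\times n}$ is any matrix $M^{(1)}\in\mathbb{C}^{n\times m}$ with $MM^{(1)}M=M$. Reproductivity: the general solution $X=g(Y)$ of an equation is reproductive if $g(Y)$ is a solution for every $Y$ and $g(X)=X$ for every solution $X$; equivalently here, the function $g$ satisfies $g\circ g=g$. Setting: $T_{A_r},T_{A_c},T_{B_r},T_{B_c}$ are permutation matrices (of orders $m,n,p,q$) such that the first $a$ rows and first $a$ columns of $\widehat{A}=T_{A_r}AT_{A_c}$ are linearly independent and the first $b$ rows and first $b$ columns of $\widehat{B}=T_{B_r}BT_{B_c}$ are linearly independent, and $\widehat{C}=T_{A_r}CT_{B_c}$. Let $W$ be the upper left $a\times a$ submatrix of $\widehat{A}$ and $U$ the upper left $b\times b$ submatrix of $\widehat{B}$. Write $M_{i\rightarrow}$ and $M_{\downarrow j}$ for the $i$-th row and $j$-th column of a matrix $M$. Scalars are defined by $\widehat{A}_{i\rightarrow}=\sum_{l=1}^{a}\alpha_{i,l}\widehat{A}_{l\rightarrow}$ ($i=a+1,\dots,m$), $\widehat{A}_{\downarrow j}=\sum_{k=1}^{a}\alpha'_{k,j}\widehat{A}_{\downarrow k}$ ($j=a+1,\dots,n$), $\widehat{B}_{i\rightarrow}=\sum_{l=1}^{b}\beta'_{i,l}\widehat{B}_{l\rightarrow}$ ($i=b+1,\dots,p$), $\widehat{B}_{\downarrow j}=\sum_{k=1}^{b}\beta_{k,j}\widehat{B}_{\downarrow k}$ ($j=b+1,\dots,q$). Put $L_1=[-\alpha_{i,l}]$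 (size $(m-a)\times a$), $L_1'=[-\alpha'_{k,j}]$ (size $a\times(n-a)$), $L_2'=[-\beta'_{i,l}]$ (size $(p-b)\times b$), $L_2=[-\beta_{k,j}]$ (size $b\times(q-b)$), and $$\widehat{Q_1}=\begin{bmatrix} I_a & 0\\ L_1 & I_{m-a}\end{bmatrix},\quad \widehat{P_1}=\begin{bmatrix} W^{-1} & L_1'\\ 0 & I_{n-a}\end{bmatrix},\quad \widehat{Q_2}=\begin{bmatrix} U^{-1} & 0\\ L_2' & I_{p-b}\end{bmatrix},\quad \widehat{P_2}=\begin{bmatrix} I_b & L_2\\ 0 & I_{q-b}\end{bmatrix}.$$ Then $Q_1=\widehat{Q_1}T_{A_r}$, $P_1=T_{A_c}\widehat{P_1}$, $Q_2=\widehat{Q_2}T_{B_r}$, $P_2=T_{B_c}\widehat{P_2}$. These are regular matrices with $$Q_1AP_1=\begin{bmatrix} I_a & 0\\ 0 & 0\end{bmatrix},\qquad Q_2BP_2=\begin{bmatrix} I_b & 0\\ 0 & 0\end{bmatrix}.$$ Every $\{1\}$-inverse of $A$ (respectively $B$) is of the form displayed in the claim for some $X_1,X_2,X_3$ (respectively $Y_1,Y_2,Y_3$). *)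

theory Defs
  imports
    "HOL-Combinatorics.Permutations"
    "Jordan_Normal_Form.Matrix"
    "Jordan_Normal_Form.Gauss_Jordan_Elimination"
    "Jordan_Normal_Form.DL_Rank"
begin

(* Matrices are those of Jordan_Normal_Form, so all row and column indices start at 0: the
   classical index range 1..a becomes {..<a}, and a+1..m becomes {a..<m}. *)

definition one_inverse :: "complex mat \<Rightarrow> complex mat \<Rightarrow> bool" where
  "one_inverse M M1 \<longleftrightarrow> M1 \<in> carrier_mat (dim_col M) (dim_row M) \<and> M * M1 * M = M"

definition permutation_matrix :: "nat \<Rightarrow> complex mat \<Rightarrow> bool" where
  "permutation_matrix n T \<longleftrightarrow>
     (\<exists>\<sigma>. \<sigma> permutes {..<n} \<and> T = mat n n (\<lambda>(i, j). if j = \<sigma> i then 1 else 0))"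

(* Linear independence of a family of vectors of length n. The library notion is about sets,
   hence the additional requirement that the family has no repetitions. *)
definition lin_indpt_list :: "nat \<Rightarrow> complex vec list \<Rightarrow> bool" where
  "lin_indpt_list n vs \<longleftrightarrow>
     distinct vs \<and> \<not> LinearCombinations.module.lin_dep class_ring (module_vec TYPE(complex) n) (set vs)"

definition upper_left :: "nat \<Rightarrow> nat \<Rightarrow> complex mat \<Rightarrow> complex mat" where
  "upper_left r s M = mat r s (\<lambda>(i, j). M $$ (i, j))"

(* Below r is the rank. In lower_coeffs and upper_coeffs the scalars carry the indices of the
   full matrix, so the entry (i, l) of the block L is taken at row r + i (column r + j). *)

definition lower_coeffs :: "nat \<Rightarrow> nat \<Rightarrow> (nat \<Rightarrow> nat \<Rightarrow> complex) \<Rightarrow> complex mat" where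
  "lower_coeffs k r \<alpha> = mat (k - r) r (\<lambda>(i, l). - \<alpha> (r + i) l)"

definition upper_coeffs :: "nat \<Rightarrow> nat \<Rightarrow> (nat \<Rightarrow> nat \<Rightarrow> complex) \<Rightarrow> complex mat" where
  "upper_coeffs k r \<beta> = mat r (k - r) (\<lambda>(l, j). - \<beta> l (r + j))"

definition lower_block :: "nat \<Rightarrow> nat \<Rightarrow> complex mat \<Rightarrow> complex mat \<Rightarrow> complex mat" where
  "lower_block k r V L = four_block_mat V (0\<^sub>m r (k - r)) L (1\<^sub>m (k - r))"

definition upper_block :: "nat \<Rightarrow> nat \<Rightarrow> complex mat \<Rightarrow> complex mat \<Rightarrow> complex mat" where
  "upper_block k r V L = four_block_mat V L (0\<^sub>m (k - r) r) (1\<^sub>m (k - r))"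

definition general_solution :: "'a set \<Rightarrow> 'a set \<Rightarrow> ('a \<Rightarrow> 'a) \<Rightarrow> bool" where
  "general_solution D S g \<longleftrightarrow> g ` D = S"

definition reproductive :: "'a set \<Rightarrow> 'a set \<Rightarrow> ('a \<Rightarrow> 'a) \<Rightarrow> bool" where
  "reproductive D S g \<longleftrightarrow> (\<forall>Y\<in>D. g Y \<in> S) \<and> (\<forall>X\<in>S. g X = X)"

end

theory Submission
  imports Defs
begin

text \<open>
  For \<open>X \<in> S\<close> the function \<open>g\<close> takes the value \<open>X0 + X - A1 * C * B1\<close>, because \<open>A * X * B = C\<close>.
  So \<open>g\<close> fixes one solution if and only if it fixes all of them, if and only if
  \<open>X0 = A1 * C * B1\<close>. Reproductivity therefore singles out exactly one particular solution, and it
  remains to compute it in block form. The values of \<open>g\<close> are solutions because \<open>A * A1 * A = A\<close> and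
  \<open>B * B1 * B = B\<close>, and every solution \<open>X\<close> occurs, as the value at \<open>X - X0\<close>
  (\<open>general_and_reproductive_solution\<close>).

  The matrices \<open>Q1\<close>, \<open>P1\<close>, \<open>Q2\<close>, \<open>P2\<close> are regular and bring \<open>A\<close> and \<open>B\<close> to the form
  \<open>[I, 0; 0, 0]\<close> (\<open>normal_form\<close>). The given coefficients express every row and column
  through the first \<open>a\<close> ones, so that the permuted matrix is \<open>[W, -W K; -L W, L W K]\<close> with \<open>L\<close> and \<open>K\<close>
  the coefficient blocks, and one block elimination clears everything outside \<open>W\<close>. Linear
  independence of the leading columns makes \<open>W\<close> regular (\<open>upper_left_regular\<close>): the whole
  list of leading columns is \<open>E * W\<close> for some \<open>E\<close>, hence a kernel vector of \<open>W\<close> is a linear relation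
  between these columns.

  Solvability enters through \<open>C = A * X0 * B\<close>: it forces \<open>Q1 * C * P2\<close> to vanish outside its upper
  left \<open>a\<close> by \<open>b\<close> block (\<open>transformed_rhs\<close>), and this block is \<open>C1\<close>, since the triangular factors of
  \<open>Q1\<close> and \<open>P2\<close> have identity matrices as their leading blocks (\<open>upper_left_unipotent\<close>). Then
  \<open>A1 * C * B1 = P1 * [I, X1; X2, X3] * [C1, 0; 0, 0] * [I, Y1; Y2, Y3] * Q2\<close>, and multiplying the three
  inner factors gives \<open>[C1, C1 Y1; X2 C1, X2 C1 Y1]\<close>.
\<close>

section \<open>Products and inverses of matrices\<close>

text \<open>
  With premises on dimensions instead of membership in \<open>carrier_mat\<close>, associativity becomes a
  rewrite rule whose side conditions the simplifier discharges from the shapes of the factors; no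
  intermediate index ranges have to be supplied. The next lemma lets inverse pairs cancel inside
  the resulting right-nested products.
\<close>

lemma mult_assoc_dims:
  fixes M N K :: "'a :: semiring_0 mat"
  assumes "dim_col M = dim_row N" "dim_col N = dim_row K"
  shows "M * N * K = M * (N * K)"
  by (rule assoc_mult_mat[of _ "dim_row M" "dim_row N" _ "dim_row K" _ "dim_col K"])
    (use assms in auto)

lemma mult_inverse_cancel:
  fixes P P' K :: "'a :: semiring_1 mat"
  assumes "P * P' = 1\<^sub>m n" "dim_col P = dim_row P'" "dim_col P' = dim_row K"
  shows "P * (P' * K) = K"
proof -
  have "dim_row K = n"
    using assms by (metis index_mult_mat(3) index_one_mat(3))
  then show ?thesis
    using mult_assoc_dims[of P P' K] assms by simp
qed

lemma det_nonzero_obtain_inverse: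
  fixes P :: "'a :: field mat"
  assumes "P \<in> carrier_mat n n" "det P \<noteq> 0"
  obtains P' where "P' \<in> carrier_mat n n" "P * P' = 1\<^sub>m n" "P' * P = 1\<^sub>m n"
  using det_non_zero_imp_unit[OF assms, of undefined]
  unfolding Units_def ring_mat_def by auto

lemma mat_inverse_det_nonzero:
  fixes W :: "'a :: field mat"
  assumes W: "W \<in> carrier_mat n n" and "det W \<noteq> 0"
  shows "the (mat_inverse W) \<in> carrier_mat n n"
    "W * the (mat_inverse W) = 1\<^sub>m n" "the (mat_inverse W) * W = 1\<^sub>m n"
proof -
  have "W \<in> Units (ring_mat TYPE('a) n undefined)"
    using det_non_zero_imp_unit[OF assms] .
  then obtain V where "mat_inverse W = Some V"
    using mat_inverse(1)[OF W, of undefined] by (cases "mat_inverse W") auto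
  then show "the (mat_inverse W) \<in> carrier_mat n n"
    "W * the (mat_inverse W) = 1\<^sub>m n" "the (mat_inverse W) * W = 1\<^sub>m n"
    using mat_inverse(2)[OF W] by auto
qed

text \<open>
  A permutation matrix is orthogonal: row \<open>i\<close> is the unit vector at \<open>\<sigma> i\<close>, and \<open>\<sigma>\<close> is injective.
\<close>

lemma permutation_matrix_regular:
  assumes "permutation_matrix n T"
  shows "T \<in> carrier_mat n n" "det T \<noteq> 0"
proof -
  obtain \<sigma> where \<sigma>: "\<sigma> permutes {..<n}" and T: "T = mat n n (\<lambda>(i, j). if j = \<sigma> i then 1 else 0)"
    using assms unfolding permutation_matrix_def by blast
  show carrier: "T \<in> carrier_mat n n"
    unfolding T by simp
  have "T * transpose_mat T = 1\<^sub>m n"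
  proof (rule eq_matI)
    fix i j assume ij: "i < dim_row (1\<^sub>m n)" "j < dim_col (1\<^sub>m n)"
    have "(T * transpose_mat T) $$ (i, j)
      = (\<Sum>k = 0..<n. (if k = \<sigma> i then 1 else 0) * (if k = \<sigma> j then 1 else 0))"
      using ij unfolding T by (simp add: scalar_prod_def)
    also have "\<dots> = (\<Sum>k = 0..<n. if k = \<sigma> i then (if \<sigma> i = \<sigma> j then 1 else 0) else 0)"
      by (rule sum.cong) auto
    also have "\<dots> = (if \<sigma> i = \<sigma> j then 1 else 0)"
      using permutes_in_image[OF \<sigma>, of i] ij by simp
    also have "\<dots> = 1\<^sub>m n $$ (i, j)"
      using ij permutes_inj[OF \<sigma>] by (auto dest: injD)
    finally show "(T * transpose_mat T) $$ (i, j) = 1\<^sub>m n $$ (i, j)" .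
  qed (use carrier in auto)
  then have "det T * det (transpose_mat T) = 1"
    using det_mult[of T n "transpose_mat T"] carrier by simp
  then show "det T \<noteq> 0"
    by auto
qed

section \<open>Triangular block matrices and the rank normal form\<close>

lemma lower_block_carrier:
  assumes "k \<le> r" "V \<in> carrier_mat k k"
  shows "lower_block r k V L \<in> carrier_mat r r"
  using assms by (auto simp: lower_block_def)

lemma upper_block_carrier:
  assumes "k \<le> r" "V \<in> carrier_mat k k"
  shows "upper_block r k V L \<in> carrier_mat r r"
  using assms by (auto simp: upper_block_def)

lemma det_lower_block:
  assumes "V \<in> carrier_mat k k" "L \<in> carrier_mat (r - k) k"
  shows "det (lower_block r k V L) = det V"
  using det_four_block_mat_upper_right_zero[OF assms(1) refl assms(2) one_carrier_mat]
  by (simp add: lower_block_def)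

lemma det_upper_block:
  assumes "V \<in> carrier_mat k k" "L \<in> carrier_mat k (r - k)"
  shows "det (upper_block r k V L) = det V"
  using det_four_block_mat_lower_left_zero[OF assms(1) assms(2) refl one_carrier_mat]
  by (simp add: upper_block_def)

definition corner_identity :: "nat \<Rightarrow> nat \<Rightarrow> nat \<Rightarrow> complex mat" where
  "corner_identity r c k =
     four_block_mat (1\<^sub>m k) (0\<^sub>m k (c - k)) (0\<^sub>m (r - k) k) (0\<^sub>m (r - k) (c - k))"

lemma corner_identity_carrier:
  "k \<le> r \<Longrightarrow> k \<le> c \<Longrightarrow> corner_identity r c k \<in> carrier_mat r c"
  by (auto simp: corner_identity_def)

section \<open>Matrices spanned by their leading rows and columns\<close>

lemma row_combination_entry:
  fixes M :: "complex mat"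
  assumes "M \<in> carrier_mat r c" "k \<le> r" "i < r" "j < c"
    and "row M i = finsum_vec TYPE(complex) c (\<lambda>l. \<alpha> i l \<cdot>\<^sub>v row M l) {..<k}"
  shows "M $$ (i, j) = (\<Sum>l = 0..<k. \<alpha> i l * M $$ (l, j))"
proof -
  have "M $$ (i, j) = finsum_vec TYPE(complex) c (\<lambda>l. \<alpha> i l \<cdot>\<^sub>v row M l) {..<k} $ j"
    using assms by (metis index_row(1) carrier_matD)
  also have "\<dots> = (\<Sum>l\<in>{..<k}. (\<alpha> i l \<cdot>\<^sub>v row M l) $ j)"
    using assms(1,4) by (intro index_finsum_vec) auto
  also have "\<dots> = (\<Sum>l = 0..<k. \<alpha> i l * M $$ (l, j))"
    using assms(1-4) by (intro sum.cong) auto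
  finally show ?thesis .
qed

lemma col_combination_entry:
  fixes M :: "complex mat"
  assumes "M \<in> carrier_mat r c" "k \<le> c" "i < r" "j < c"
    and "col M j = finsum_vec TYPE(complex) r (\<lambda>l. \<alpha> l j \<cdot>\<^sub>v col M l) {..<k}"
  shows "M $$ (i, j) = (\<Sum>l = 0..<k. \<alpha> l j * M $$ (i, l))"
proof -
  have "M $$ (i, j) = finsum_vec TYPE(complex) r (\<lambda>l. \<alpha> l j \<cdot>\<^sub>v col M l) {..<k} $ i"
    using assms by (metis index_col carrier_matD)
  also have "\<dots> = (\<Sum>l\<in>{..<k}. (\<alpha> l j \<cdot>\<^sub>v col M l) $ i)"
    using assms(1,3) by (intro index_finsum_vec) auto
  also have "\<dots> = (\<Sum>l = 0..<k. \<alpha> l j * M $$ (i, l))"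
    using assms(1-4) by (intro sum.cong) auto
  finally show ?thesis .
qed

text \<open>
  The column coefficients give the upper right block from \<open>W\<close>, the row coefficients give the lower
  left one, and the lower right block follows by expressing its rows through the upper right
  block. Both coefficient blocks carry a minus sign by definition, whence the signs here.
\<close>

lemma four_block_of_combinations:
  fixes M :: "complex mat"
  assumes M: "M \<in> carrier_mat r c" and k: "k \<le> r" "k \<le> c"
    and rows: "\<And>i. i \<in> {k..<r} \<Longrightarrow>
      row M i = finsum_vec TYPE(complex) c (\<lambda>l. \<alpha> i l \<cdot>\<^sub>v row M l) {..<k}"
    and cols: "\<And>j. j \<in> {k..<c} \<Longrightarrow>
      col M j = finsum_vec TYPE(complex) r (\<lambda>l. \<beta> l j \<cdot>\<^sub>v col M l) {..<k}"
  defines "W \<equiv> upper_left k k M"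
    and "L \<equiv> lower_coeffs r k \<alpha>" and "K \<equiv> upper_coeffs c k \<beta>"
  shows "M = four_block_mat W (- (W * K)) (- (L * W)) (L * (W * K))"
proof (rule eq_matI)
  let ?F = "four_block_mat W (- (W * K)) (- (L * W)) (L * (W * K))"
  have dims [simp]: "dim_row W = k" "dim_col W = k" "dim_row L = r - k" "dim_col L = k"
    "dim_row K = k" "dim_col K = c - k"
    by (simp_all add: W_def L_def K_def upper_left_def lower_coeffs_def upper_coeffs_def)
  show "dim_row M = dim_row ?F" "dim_col M = dim_col ?F"
    using M k by auto
  have W: "W $$ (i, j) = M $$ (i, j)" if "i < k" "j < k" for i j
    using that by (simp add: W_def upper_left_def)
  have right: "(W * K) $$ (i, j) = - M $$ (i, k + j)" if "i < k" "j < c - k" for i j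
    using col_combination_entry[where \<alpha> = \<beta> and i = i and j = "k + j", OF M k(2) _ _ cols] that k
    by (auto simp: scalar_prod_def W K_def upper_coeffs_def sum_negf mult.commute
        intro!: sum.cong)
  have left: "(L * W) $$ (i, j) = - M $$ (k + i, j)" if "i < r - k" "j < k" for i j
    using row_combination_entry[where \<alpha> = \<alpha> and i = "k + i" and j = j, OF M k(1) _ _ rows] that k
    by (auto simp: scalar_prod_def W L_def lower_coeffs_def sum_negf intro!: sum.cong)
  have low: "(L * (W * K)) $$ (i, j) = M $$ (k + i, k + j)" if "i < r - k" "j < c - k" for i j
  proof -
    have "(L * (W * K)) $$ (i, j) = (\<Sum>l = 0..<k. L $$ (i, l) * (W * K) $$ (l, j))"
      using that by (auto simp: scalar_prod_def intro!: sum.cong)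
    also have "\<dots> = (\<Sum>l = 0..<k. \<alpha> (k + i) l * M $$ (l, k + j))"
      using that right by (intro sum.cong) (auto simp: L_def lower_coeffs_def)
    also have "\<dots> = M $$ (k + i, k + j)"
      using row_combination_entry[where \<alpha> = \<alpha> and i = "k + i" and j = "k + j", OF M k(1) _ _ rows] that by auto
    finally show ?thesis .
  qed
  fix i j assume ij: "i < dim_row ?F" "j < dim_col ?F"
  then have "i < r" "j < c" using k by auto
  then show "M $$ (i, j) = ?F $$ (i, j)"
    using ij W right[of i "j - k"] left[of "i - k" j] low[of "i - k" "j - k"] k
    by (auto simp del: index_mult_mat(1))
qed

text \<open>
  The left factor removes the lower block row, and the right factor then removes the remaining
  upper right block. Since only \<open>V * W * V' = 1\<close> is required, the inverse of \<open>W\<close> may be placed on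
  either side, which covers the reductions of both \<open>A\<close> and \<open>B\<close>.
\<close>

lemma block_elimination:
  fixes V W V' L K :: "complex mat"
  assumes k: "k \<le> r" "k \<le> c"
    and carriers: "V \<in> carrier_mat k k" "W \<in> carrier_mat k k" "V' \<in> carrier_mat k k"
      "L \<in> carrier_mat (r - k) k" "K \<in> carrier_mat k (c - k)"
    and VWV': "V * W * V' = 1\<^sub>m k"
  shows "lower_block r k V L * four_block_mat W (- (W * K)) (- (L * W)) (L * (W * K))
    * upper_block c k V' K = corner_identity r c k"
proof -
  have LW: "L * W + - (L * W) = 0\<^sub>m (r - k) k"
    and LWK: "L * - (W * K) + L * (W * K) = 0\<^sub>m (r - k) (c - k)"
    and VWK: "V * W * K + V * - (W * K) = 0\<^sub>m k (c - k)"
    using carriers by (auto simp: mult_assoc_dims)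
  have "lower_block r k V L * four_block_mat W (- (W * K)) (- (L * W)) (L * (W * K))
    = four_block_mat (V * W) (V * - (W * K)) (0\<^sub>m (r - k) k) (0\<^sub>m (r - k) (c - k))"
    unfolding lower_block_def
    by (subst mult_four_block_mat[of _ k k _ "r - k" _ "r - k" _ _ k _ "c - k"])
      (use carriers LW LWK in auto)
  also have "\<dots> * upper_block c k V' K = corner_identity r c k"
    unfolding upper_block_def corner_identity_def
    by (subst mult_four_block_mat[of _ k k _ "c - k" _ "r - k" _ _ k _ "c - k"])
      (use carriers VWV' VWK in auto)
  finally show ?thesis .
qed

lemma lin_indpt_list_length:
  assumes "lin_indpt_list n vs" "set vs \<subseteq> carrier_vec n"
  shows "length vs \<le> n"
proof -
  interpret vec_space "TYPE(complex)" n .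
  have "distinct vs" "lin_indpt (set vs)"
    using assms(1) unfolding lin_indpt_list_def by auto
  then show ?thesis
    using li_le_dim(2)[OF fin_dim, of "set vs"] assms(2) dim_is_n distinct_card[of vs] by simp
qed

lemma lin_indpt_cols_trivial_kernel:
  assumes N: "N \<in> carrier_mat r k" and indep: "lin_indpt_list r (cols N)"
    and v: "v \<in> carrier_vec k" "N *\<^sub>v v = 0\<^sub>v r"
  shows "v = 0\<^sub>v k"
proof -
  interpret vec_space "TYPE(complex)" r .
  have "distinct (cols N)" "lin_indpt (set (cols N))"
    using indep unfolding lin_indpt_list_def by auto
  then show ?thesis
    using lin_depI[OF N v(1) _ v(2)] by blast
qed

text \<open>
  The rows below \<open>k\<close> of the leading columns are combinations of the rows of the upper left block, by
  the same coefficients as in the full matrix. A vector annihilated by that block is hence a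
  linear relation between the leading columns, and so it is zero.
\<close>

lemma upper_left_regular:
  fixes M :: "complex mat"
  assumes M: "M \<in> carrier_mat r c" and k: "k \<le> c"
    and indep: "lin_indpt_list r (map (col M) [0..<k])"
    and rows: "\<And>i. i \<in> {k..<r} \<Longrightarrow>
      row M i = finsum_vec TYPE(complex) c (\<lambda>l. \<alpha> i l \<cdot>\<^sub>v row M l) {..<k}"
  shows "k \<le> r" "det (upper_left k k M) \<noteq> 0"
proof -
  let ?vs = "map (col M) [0..<k]"
  have vs: "set ?vs \<subseteq> carrier_vec r"
    using M by auto
  show kr: "k \<le> r"
    using lin_indpt_list_length[OF indep vs] by simp
  define W where "W = upper_left k k M"
  define N where "N = mat_of_cols r ?vs"
  \<comment> \<open>\<open>E\<close> is the identity above the coefficients \<open>\<alpha>\<close>, so that \<open>E * W\<close> rebuilds the leading columns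
    from their upper part.\<close>
  define E where "E = mat r k (\<lambda>(i, l). if i < k then (if i = l then 1 else 0) else \<alpha> i l)"
  have W: "W \<in> carrier_mat k k" and N: "N \<in> carrier_mat r k" and E: "E \<in> carrier_mat r k"
    by (auto simp: W_def N_def E_def upper_left_def)
  have N_E: "N = E * W"
  proof (rule eq_matI)
    fix i j assume "i < dim_row (E * W)" "j < dim_col (E * W)"
    then have ij: "i < r" "j < k" using E W by auto
    have "N $$ (i, j) = M $$ (i, j)"
      using ij M k by (simp add: N_def mat_of_cols_index)
    also have "\<dots> = (\<Sum>l = 0..<k. E $$ (i, l) * M $$ (l, j))"
    proof (cases "i < k")
      case True
      have "(\<Sum>l = 0..<k. E $$ (i, l) * M $$ (l, j)) = (\<Sum>l = 0..<k. if l = i then M $$ (i, j) else 0)"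
        using True ij by (intro sum.cong) (auto simp: E_def)
      then show ?thesis using True by simp
    next
      case False
      then show ?thesis
        using row_combination_entry[where \<alpha> = \<alpha> and i = i and j = j, OF M kr ij(1) _ rows] ij k
        by (auto simp: E_def intro!: sum.cong)
    qed
    also have "\<dots> = (E * W) $$ (i, j)"
      using ij E W by (auto simp: scalar_prod_def W_def upper_left_def intro!: sum.cong)
    finally show "N $$ (i, j) = (E * W) $$ (i, j)" .
  qed (use N E W in auto)
  have cols_N: "cols N = ?vs"
    unfolding N_def using vs by (intro cols_mat_of_cols) auto
  show "det (upper_left k k M) \<noteq> 0"
  proof
    assume "det (upper_left k k M) = 0"
    then obtain v where v: "v \<in> carrier_vec k" "v \<noteq> 0\<^sub>v k" "W *\<^sub>v v = 0\<^sub>v k"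
      using det_0_iff_vec_prod_zero_field[OF W] W_def by auto
    then have "N *\<^sub>v v = 0\<^sub>v r"
      unfolding N_E using E W by (subst assoc_mult_mat_vec[of _ r k _ k]) auto
    from lin_indpt_cols_trivial_kernel[OF N _ v(1) this] cols_N indep v(2) show False
      by simp
  qed
qed

section \<open>Reduction to the rank normal form\<close>

text \<open>
  Regularity of \<open>Q\<close> and \<open>P\<close> comes from the block triangular shape: up to the determinants of the
  permutation matrices, their determinants are those of \<open>V\<close> and \<open>V'\<close>, which are nonzero because
  \<open>V * W * V' = 1\<close>.
\<close>

lemma normal_form:
  fixes M :: "complex mat"
  assumes M: "M \<in> carrier_mat r c" and k: "k \<le> r" "k \<le> c"
    and perm: "permutation_matrix r Tr" "permutation_matrix c Tc"
    and Mhat: "Mhat = Tr * M * Tc"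
    and rows: "\<And>i. i \<in> {k..<r} \<Longrightarrow>
      row Mhat i = finsum_vec TYPE(complex) c (\<lambda>l. \<alpha> i l \<cdot>\<^sub>v row Mhat l) {..<k}"
    and cols: "\<And>j. j \<in> {k..<c} \<Longrightarrow>
      col Mhat j = finsum_vec TYPE(complex) r (\<lambda>l. \<beta> l j \<cdot>\<^sub>v col Mhat l) {..<k}"
    and V: "V \<in> carrier_mat k k" "V' \<in> carrier_mat k k"
    and VWV': "V * upper_left k k Mhat * V' = 1\<^sub>m k"
  defines "Q \<equiv> lower_block r k V (lower_coeffs r k \<alpha>) * Tr"
    and "P \<equiv> Tc * upper_block c k V' (upper_coeffs c k \<beta>)"
  shows "Q \<in> carrier_mat r r" "det Q \<noteq> 0" "P \<in> carrier_mat c c" "det P \<noteq> 0"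
    "Q * M * P = corner_identity r c k"
proof -
  let ?L = "lower_coeffs r k \<alpha>" and ?K = "upper_coeffs c k \<beta>" and ?W = "upper_left k k Mhat"
  note T = permutation_matrix_regular[OF perm(1)] permutation_matrix_regular[OF perm(2)]
  have L: "?L \<in> carrier_mat (r - k) k" and K: "?K \<in> carrier_mat k (c - k)"
    and W: "?W \<in> carrier_mat k k"
    by (auto simp: lower_coeffs_def upper_coeffs_def upper_left_def)
  note Q' = lower_block_carrier[OF k(1) V(1), of ?L]
  note P' = upper_block_carrier[OF k(2) V(2), of ?K]
  have "det (V * ?W * V') = 1"
    using VWV' by simp
  then have "det V * det ?W * det V' = 1"
    using V W by (simp add: det_mult[of _ k] mult.assoc)
  then have det_V: "det V \<noteq> 0" "det V' \<noteq> 0"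
    by auto
  show Q: "Q \<in> carrier_mat r r" and P: "P \<in> carrier_mat c c"
    unfolding Q_def P_def using Q' P' T by auto
  show "det Q \<noteq> 0"
    unfolding Q_def using det_mult[OF Q' T(1)] det_lower_block[OF V(1) L] det_V T by simp
  show "det P \<noteq> 0"
    unfolding P_def using det_mult[OF T(3) P'] det_upper_block[OF V(2) K] det_V T by simp
  have Mhat_carrier: "Mhat \<in> carrier_mat r c"
    unfolding Mhat using T M by auto
  have "Q * M * P = lower_block r k V ?L * Mhat * upper_block c k V' ?K"
    using Q' P' T M unfolding Q_def P_def Mhat by (simp add: mult_assoc_dims)
  also have "Mhat = four_block_mat ?W (- (?W * ?K)) (- (?L * ?W)) (?L * (?W * ?K))"
    by (rule four_block_of_combinations[OF Mhat_carrier k rows cols])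
  also have "lower_block r k V ?L * \<dots> * upper_block c k V' ?K = corner_identity r c k"
    by (rule block_elimination[OF k V(1) W V(2) L K VWV'])
  finally show "Q * M * P = corner_identity r c k" .
qed

text \<open>
  After cancelling \<open>P\<close> and \<open>Q\<close> against their inverses, the defining equation reduces to \<open>D * F * D = D\<close>
  for the normal form \<open>D\<close>, and \<open>D\<close> sees only the upper left block of \<open>F\<close>, which is the identity.
\<close>

lemma one_inverse_from_normal_form:
  fixes M :: "complex mat"
  assumes M: "M \<in> carrier_mat r c" and k: "k \<le> r" "k \<le> c"
    and Q: "Q \<in> carrier_mat r r" "det Q \<noteq> 0" and P: "P \<in> carrier_mat c c" "det P \<noteq> 0"
    and QMP: "Q * M * P = corner_identity r c k"
    and Z: "Z1 \<in> carrier_mat k (r - k)" "Z2 \<in> carrier_mat (c - k) k" "Z3 \<in> carrier_mat (c - k) (r - k)"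
  shows "one_inverse M (P * four_block_mat (1\<^sub>m k) Z1 Z2 Z3 * Q)"
proof -
  define F where "F = four_block_mat (1\<^sub>m k) Z1 Z2 Z3"
  define D where "D = corner_identity r c k"
  obtain Q' where Q': "Q' \<in> carrier_mat r r" "Q * Q' = 1\<^sub>m r" "Q' * Q = 1\<^sub>m r"
    using det_nonzero_obtain_inverse[OF Q] .
  obtain P' where P': "P' \<in> carrier_mat c c" "P * P' = 1\<^sub>m c" "P' * P = 1\<^sub>m c"
    using det_nonzero_obtain_inverse[OF P] .
  have F: "F \<in> carrier_mat c r"
    using Z k unfolding F_def by auto
  have D: "D \<in> carrier_mat r c"
    unfolding D_def using k by (rule corner_identity_carrier)
  have M_D: "M = Q' * (D * P')"
    unfolding D_def QMP[symmetric] using M P Q P' Q'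
    by (simp add: mult_assoc_dims mult_inverse_cancel[of Q' Q r])
  have "D * F = four_block_mat (1\<^sub>m k) Z1 (0\<^sub>m (r - k) k) (0\<^sub>m (r - k) (r - k))"
    unfolding D_def F_def corner_identity_def
    by (subst mult_four_block_mat[of _ k k _ "c - k" _ "r - k" _ _ k _ "r - k"]) (use Z in auto)
  also have "\<dots> * D = D"
    unfolding D_def corner_identity_def
    by (subst mult_four_block_mat[of _ k k _ "r - k" _ "r - k" _ _ k _ "c - k"]) (use Z in auto)
  finally have DFD: "D * (F * D) = D"
    using D F by (simp add: mult_assoc_dims)
  have "M * (P * F * Q) * M = Q' * (D * (F * D) * P')"
    unfolding M_D using P Q P' Q' D F
    by (simp add: mult_assoc_dims mult_inverse_cancel[of P' P c] mult_inverse_cancel[of Q Q' r])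
  also have "\<dots> = M"
    unfolding DFD M_D ..
  finally show ?thesis
    unfolding one_inverse_def F_def[symmetric] using M P Q F by auto
qed

section \<open>Solutions of the matrix equation\<close>

text \<open>
  On solutions, \<open>A1 * A * X * B * B1\<close> is the constant \<open>A1 * C * B1\<close>. This makes \<open>g\<close> a translation on \<open>S\<close>, and
  a translation that fixes a point is the identity.
\<close>

lemma general_and_reproductive_solution:
  assumes A: "A \<in> carrier_mat m n" and B: "B \<in> carrier_mat p q"
    and S: "S = {X \<in> carrier_mat n p. A * X * B = C}" and X0: "X0 \<in> S"
    and A1: "one_inverse A A1" and B1: "one_inverse B B1"
    and g: "g = (\<lambda>Y. X0 + Y - A1 * A * Y * B * B1)"
  shows "general_solution (carrier_mat n p) S g"
    and "reproductive (carrier_mat n p) S g \<longleftrightarrow> X0 = A1 * C * B1"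
proof -
  have carriers: "A1 \<in> carrier_mat n m" "B1 \<in> carrier_mat q p" "X0 \<in> carrier_mat n p"
    and AA1A: "A * A1 * A = A" and BB1B: "B * B1 * B = B" and AX0B: "A * X0 * B = C"
    using A1 B1 X0 A B unfolding one_inverse_def S by auto
  have C: "C \<in> carrier_mat m q"
    using AX0B A B carriers by auto
  note all = carriers A B C
  have in_S: "g Y \<in> S" if Y: "Y \<in> carrier_mat n p" for Y
  proof -
    let ?Z = "A1 * A * Y * B * B1"
    have Z: "?Z \<in> carrier_mat n p" using all Y by auto
    have AZ: "A * ?Z * B = A * A1 * A * Y * (B * B1 * B)"
      using all Y by (simp add: mult_assoc_dims)
    then have AZB: "A * ?Z * B = A * Y * B"
      by (simp only: AA1A BB1B)
    have "A * (X0 + Y - ?Z) * B = A * X0 * B + A * Y * B - A * ?Z * B"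
      using all Y Z by (simp add: mult_minus_distrib_mat[of _ m n _ p] minus_mult_distrib_mat[of _ m p _ _ q]
          mult_add_distrib_mat[of _ m n _ p] add_mult_distrib_mat[of _ m p _ _ q])
    also have "\<dots> = C"
      unfolding AZB AX0B using all Y by (intro eq_matI) auto
    finally have "A * (X0 + Y - ?Z) * B = C" .
    moreover have "X0 + Y - ?Z \<in> carrier_mat n p"
      using Z by (rule minus_carrier_mat)
    ultimately show ?thesis
      unfolding g S by blast
  qed
  have g_S: "g X = X0 + X - A1 * C * B1" if "X \<in> S" for X
  proof -
    have X: "X \<in> carrier_mat n p" "A * X * B = C" using that unfolding S by auto
    have "A1 * A * X * B * B1 = A1 * (A * X * B) * B1"
      using all X(1) by (simp add: mult_assoc_dims)
    then show ?thesis unfolding g X(2) by simp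
  qed
  show "general_solution (carrier_mat n p) S g"
    unfolding general_solution_def
  proof (intro equalityI subsetI)
    fix X assume X: "X \<in> S"
    then have Xc: "X \<in> carrier_mat n p" "A * X * B = C" unfolding S by auto
    \<comment> \<open>The preimage \<open>X - X0\<close> solves the homogeneous equation, so the correction term vanishes.\<close>
    have "A1 * A * (X - X0) * B * B1 = A1 * (A * (X - X0) * B) * B1"
      using all Xc(1) by (simp add: mult_assoc_dims)
    also have "A * (X - X0) * B = A * X * B - A * X0 * B"
      using all Xc by (simp add: mult_minus_distrib_mat[of _ m n _ p] minus_mult_distrib_mat[of _ m p _ _ q])
    also have "\<dots> = 0\<^sub>m m q"
      unfolding Xc(2) AX0B using C by auto
    also have "A1 * 0\<^sub>m m q * B1 = 0\<^sub>m n p"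
      using all by simp
    finally have "g (X - X0) = X"
      unfolding g using all Xc by (intro eq_matI) auto
    moreover have "X - X0 \<in> carrier_mat n p" using all by auto
    ultimately show "X \<in> g ` carrier_mat n p" by (metis imageI)
  qed (use in_S in auto)
  have "g X = X \<longleftrightarrow> X0 = A1 * C * B1" if X: "X \<in> S" for X
  proof -
    have Xc: "X \<in> carrier_mat n p" and G: "A1 * C * B1 \<in> carrier_mat n p"
      using X all unfolding S by auto
    have "X0 + X - G = X \<longleftrightarrow> X0 = G" if G: "G \<in> carrier_mat n p" for G
    proof
      assume eq: "X0 + X - G = X"
      show "X0 = G"
      proof (rule eq_matI)
        fix i j assume "i < dim_row G" "j < dim_col G"
        then show "X0 $$ (i, j) = G $$ (i, j)"
          using arg_cong[OF eq, of "\<lambda>M. M $$ (i, j)"] G Xc all by auto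
      qed (use G all in auto)
    next
      assume "X0 = G"
      then show "X0 + X - G = X"
        using G Xc by (intro eq_matI) auto
    qed
    from this[OF G] show ?thesis unfolding g_S[OF X] .
  qed
  then show "reproductive (carrier_mat n p) S g \<longleftrightarrow> X0 = A1 * C * B1"
    unfolding reproductive_def using in_S X0 by blast
qed

text \<open>
  If \<open>C = A * X * B\<close>, then \<open>Q1 * C * P2 = D * Z * D'\<close> with \<open>D\<close>, \<open>D'\<close> the normal forms of \<open>A\<close>, \<open>B\<close> and \<open>Z\<close>
  the solution in the new coordinates. Multiplication by \<open>D\<close> and \<open>D'\<close> erases all rows of \<open>Z\<close> from \<open>a\<close>
  on and all columns from \<open>b\<close> on.
\<close>

lemma transformed_rhs:
  fixes A B C :: "complex mat"
  assumes A: "A \<in> carrier_mat m n" and B: "B \<in> carrier_mat p q"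
    and X: "X \<in> carrier_mat n p" "A * X * B = C"
    and le: "a \<le> m" "a \<le> n" "b \<le> p" "b \<le> q"
    and Q1: "Q1 \<in> carrier_mat m m" and P1: "P1 \<in> carrier_mat n n" "det P1 \<noteq> 0"
    and Q2: "Q2 \<in> carrier_mat p p" "det Q2 \<noteq> 0" and P2: "P2 \<in> carrier_mat q q"
    and nfA: "Q1 * A * P1 = corner_identity m n a" and nfB: "Q2 * B * P2 = corner_identity p q b"
  shows "Q1 * C * P2 = four_block_mat (upper_left a b (Q1 * C * P2)) (0\<^sub>m a (q - b))
    (0\<^sub>m (m - a) b) (0\<^sub>m (m - a) (q - b))"
proof -
  obtain P' where P': "P' \<in> carrier_mat n n" "P1 * P' = 1\<^sub>m n"
    using det_nonzero_obtain_inverse[OF P1] by metis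
  obtain Q' where Q': "Q' \<in> carrier_mat p p" "Q' * Q2 = 1\<^sub>m p"
    using det_nonzero_obtain_inverse[OF Q2] by metis
  define Z where "Z = P' * (X * Q')"
  have Z: "Z \<in> carrier_mat n p" unfolding Z_def using P' Q' X by auto
  obtain Z1 Z2 Z3 Z4 where split: "split_block Z a b = (Z1, Z2, Z3, Z4)"
    by (metis prod_cases4)
  have blocks: "Z1 \<in> carrier_mat a b" "Z2 \<in> carrier_mat a (p - b)" "Z3 \<in> carrier_mat (n - a) b"
    "Z4 \<in> carrier_mat (n - a) (p - b)" "Z = four_block_mat Z1 Z2 Z3 Z4"
    using split_block[OF split, of "n - a" "p - b"] Z le by auto
  have "Q1 * C * P2 = (Q1 * A * P1) * Z * (Q2 * B * P2)"
    unfolding Z_def X(2)[symmetric] using A B X(1) Q1 P1 Q2 P2 P' Q'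
    by (simp add: mult_assoc_dims mult_inverse_cancel[of P1 P' n] mult_inverse_cancel[of Q' Q2 p])
  also have "corner_identity m n a * Z
    = four_block_mat Z1 Z2 (0\<^sub>m (m - a) b) (0\<^sub>m (m - a) (p - b))"
    unfolding corner_identity_def blocks(5)
    by (subst mult_four_block_mat[of _ a a _ "n - a" _ "m - a" _ _ b _ "p - b"]) (use blocks in auto)
  hence "(Q1 * A * P1) * Z * (Q2 * B * P2)
    = four_block_mat Z1 Z2 (0\<^sub>m (m - a) b) (0\<^sub>m (m - a) (p - b)) * corner_identity p q b"
    unfolding nfA nfB by simp
  also have "\<dots> = four_block_mat Z1 (0\<^sub>m a (q - b)) (0\<^sub>m (m - a) b) (0\<^sub>m (m - a) (q - b))"
    unfolding corner_identity_def
    by (subst mult_four_block_mat[of _ a b _ "p - b" _ "m - a" _ _ b _ "q - b"]) (use blocks in auto)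
  finally have eq: "Q1 * C * P2 = \<dots>" .
  have "upper_left a b (Q1 * C * P2) = Z1"
    unfolding eq upper_left_def using blocks(1) by (intro eq_matI) auto
  with eq show ?thesis by simp
qed

text \<open>
  The left factor adds multiples of the upper rows to lower rows only, the right factor adds
  multiples of the left columns to columns further right only, so the corner stays as it is.
\<close>

lemma upper_left_unipotent:
  fixes M :: "complex mat"
  assumes M: "M \<in> carrier_mat m q" and le: "a \<le> m" "b \<le> q"
    and L: "L \<in> carrier_mat (m - a) a" and K: "K \<in> carrier_mat b (q - b)"
  shows "upper_left a b (lower_block m a (1\<^sub>m a) L * M * upper_block q b (1\<^sub>m b) K)
    = upper_left a b M"
proof -
  obtain M1 M2 M3 M4 where split: "split_block M a b = (M1, M2, M3, M4)"
    by (metis prod_cases4)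
  have blocks: "M1 \<in> carrier_mat a b" "M2 \<in> carrier_mat a (q - b)" "M3 \<in> carrier_mat (m - a) b"
    "M4 \<in> carrier_mat (m - a) (q - b)" "M = four_block_mat M1 M2 M3 M4"
    using split_block[OF split, of "m - a" "q - b"] M le by auto
  have "lower_block m a (1\<^sub>m a) L * M = four_block_mat M1 M2 (L * M1 + M3) (L * M2 + M4)"
    unfolding lower_block_def blocks(5)
    by (subst mult_four_block_mat[of _ a a _ "m - a" _ "m - a" _ _ b _ "q - b"])
      (use blocks L in auto)
  also have "\<dots> * upper_block q b (1\<^sub>m b) K
    = four_block_mat M1 (M1 * K + M2) (L * M1 + M3) ((L * M1 + M3) * K + (L * M2 + M4))"
    unfolding upper_block_def
    by (subst mult_four_block_mat[of _ a b _ "q - b" _ "m - a" _ _ b _ "q - b"])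
      (use blocks L K in auto)
  finally have eq: "lower_block m a (1\<^sub>m a) L * M * upper_block q b (1\<^sub>m b) K = \<dots>" .
  show ?thesis
    unfolding eq unfolding blocks(5) upper_left_def using blocks(1-4) L K by (intro eq_matI) auto
qed

section \<open>Reproductive general solutions\<close>

theorem theorem2p11:
  fixes A B C X0 :: "complex mat"
    and m n p q a b :: nat
    and TAr TAc TBr TBc Ahat Bhat Chat W U :: "complex mat"
    and \<alpha> \<alpha>' \<beta> \<beta>' :: "nat \<Rightarrow> nat \<Rightarrow> complex"
    and L1 L1' L2 L2' Q1 P1 Q2 P2 :: "complex mat"
    and X1 X2 X3 Y1 Y2 Y3 A1 B1 C1 :: "complex mat"
    and g :: "complex mat \<Rightarrow> complex mat"
    and S :: "complex mat set"
  assumes A: "A \<in> carrier_mat m n" "vec_space.rank m A = a"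
    and B: "B \<in> carrier_mat p q" "vec_space.rank p B = b"
    and C: "C \<in> carrier_mat m q"
    and S: "S = {X \<in> carrier_mat n p. A * X * B = C}"
    and X0: "X0 \<in> S"
    and perm: "permutation_matrix m TAr" "permutation_matrix n TAc"
      "permutation_matrix p TBr" "permutation_matrix q TBc"
    and hat: "Ahat = TAr * A * TAc" "Bhat = TBr * B * TBc" "Chat = TAr * C * TBc"
    and indep_A: "lin_indpt_list n (map (row Ahat) [0..<a])"
      "lin_indpt_list m (map (col Ahat) [0..<a])"
    and indep_B: "lin_indpt_list q (map (row Bhat) [0..<b])"
      "lin_indpt_list p (map (col Bhat) [0..<b])"
    and WU: "W = upper_left a a Ahat" "U = upper_left b b Bhat"
    and \<alpha>: "\<And>i. i \<in> {a..<m} \<Longrightarrow>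
      row Ahat i = finsum_vec TYPE(complex) n (\<lambda>l. \<alpha> i l \<cdot>\<^sub>v row Ahat l) {..<a}"
    and \<alpha>': "\<And>j. j \<in> {a..<n} \<Longrightarrow>
      col Ahat j = finsum_vec TYPE(complex) m (\<lambda>k. \<alpha>' k j \<cdot>\<^sub>v col Ahat k) {..<a}"
    and \<beta>': "\<And>i. i \<in> {b..<p} \<Longrightarrow>
      row Bhat i = finsum_vec TYPE(complex) q (\<lambda>l. \<beta>' i l \<cdot>\<^sub>v row Bhat l) {..<b}"
    and \<beta>: "\<And>j. j \<in> {b..<q} \<Longrightarrow>
      col Bhat j = finsum_vec TYPE(complex) p (\<lambda>k. \<beta> k j \<cdot>\<^sub>v col Bhat k) {..<b}"
    and L: "L1 = lower_coeffs m a \<alpha>" "L1' = upper_coeffs n a \<alpha>'"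
      "L2' = lower_coeffs p b \<beta>'" "L2 = upper_coeffs q b \<beta>"
    and Q1: "Q1 = lower_block m a (1\<^sub>m a) L1 * TAr"
    and P1: "P1 = TAc * upper_block n a (the (mat_inverse W)) L1'"
    and Q2: "Q2 = lower_block p b (the (mat_inverse U)) L2' * TBr"
    and P2: "P2 = TBc * upper_block q b (1\<^sub>m b) L2"
    and X: "X1 \<in> carrier_mat a (m - a)" "X2 \<in> carrier_mat (n - a) a"
      "X3 \<in> carrier_mat (n - a) (m - a)"
    and Y: "Y1 \<in> carrier_mat b (p - b)" "Y2 \<in> carrier_mat (q - b) b"
      "Y3 \<in> carrier_mat (q - b) (p - b)"
    and A1: "A1 = P1 * four_block_mat (1\<^sub>m a) X1 X2 X3 * Q1"
    and B1: "B1 = P2 * four_block_mat (1\<^sub>m b) Y1 Y2 Y3 * Q2"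
    and C1: "C1 = upper_left a b Chat"
    and g: "g = (\<lambda>Y. X0 + Y - A1 * A * Y * B * B1)"
  shows "one_inverse A A1 \<and> one_inverse B B1 \<and>
    general_solution (carrier_mat n p) S g \<and>
    (reproductive (carrier_mat n p) S g \<longleftrightarrow>
      X0 = P1 * four_block_mat C1 (C1 * Y1) (X2 * C1) (X2 * C1 * Y1) * Q2)"
proof -
  note T = permutation_matrix_regular(1)[OF perm(1)] permutation_matrix_regular(1)[OF perm(2)]
    permutation_matrix_regular(1)[OF perm(3)] permutation_matrix_regular(1)[OF perm(4)]
  have Ahat: "Ahat \<in> carrier_mat m n" and Bhat: "Bhat \<in> carrier_mat p q"
    and Chat: "Chat \<in> carrier_mat m q"
    unfolding hat using T A B C by auto
  have le: "a \<le> n" "b \<le> q"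
    using vec_space.rank_le_nc[OF A(1)] vec_space.rank_le_nc[OF B(1)] A(2) B(2) by auto
  note detW = upper_left_regular[OF Ahat le(1) indep_A(2) \<alpha>]
  note detU = upper_left_regular[OF Bhat le(2) indep_B(2) \<beta>']
  have W: "W \<in> carrier_mat a a" "det W \<noteq> 0" and U: "U \<in> carrier_mat b b" "det U \<noteq> 0"
    using detW(2) detU(2) unfolding WU by (auto simp: upper_left_def)
  note W' = mat_inverse_det_nonzero[OF W] and U' = mat_inverse_det_nonzero[OF U]
  \<comment> \<open>The inverse of \<open>W\<close> sits in the right factor \<open>P1\<close>, the inverse of \<open>U\<close> in the left factor \<open>Q2\<close>.\<close>
  have one_W: "1\<^sub>m a * upper_left a a Ahat * the (mat_inverse W) = 1\<^sub>m a"
    and U_one: "the (mat_inverse U) * upper_left b b Bhat * 1\<^sub>m b = 1\<^sub>m b"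
    unfolding WU[symmetric] using W U W' U' by auto
  note nfA = normal_form[OF A(1) detW(1) le(1) perm(1,2) hat(1) \<alpha> \<alpha>' one_carrier_mat W'(1) one_W,
      folded L, folded Q1 P1]
  note nfB = normal_form[OF B(1) detU(1) le(2) perm(3,4) hat(2) \<beta>' \<beta> U'(1) one_carrier_mat U_one,
      folded L, folded Q2 P2]
  have inverses: "one_inverse A A1" "one_inverse B B1"
    unfolding A1 B1
    using one_inverse_from_normal_form[OF A(1) detW(1) le(1) nfA X]
      one_inverse_from_normal_form[OF B(1) detU(1) le(2) nfB Y] by auto
  have X0': "X0 \<in> carrier_mat n p" "A * X0 * B = C"
    using X0 unfolding S by auto
  have Lc: "L1 \<in> carrier_mat (m - a) a" "L2 \<in> carrier_mat b (q - b)"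
    unfolding L by (auto simp: lower_coeffs_def upper_coeffs_def)
  note Q1' = lower_block_carrier[OF detW(1) one_carrier_mat, of L1]
  note P2' = upper_block_carrier[OF le(2) one_carrier_mat, of L2]
  have "Q1 * C * P2 = lower_block m a (1\<^sub>m a) L1 * Chat * upper_block q b (1\<^sub>m b) L2"
    unfolding Q1 P2 hat using Q1' P2' T C by (simp add: mult_assoc_dims)
  then have "upper_left a b (Q1 * C * P2) = C1"
    unfolding C1 using upper_left_unipotent[OF Chat detW(1) le(2) Lc] by simp
  then have core: "Q1 * C * P2
    = four_block_mat C1 (0\<^sub>m a (q - b)) (0\<^sub>m (m - a) b) (0\<^sub>m (m - a) (q - b))"
    using transformed_rhs[OF A(1) B(1) X0' detW(1) le(1) detU(1) le(2) nfA(1,3,4) nfB(1,2,3)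
        nfA(5) nfB(5)] by simp
  have C1c: "C1 \<in> carrier_mat a b"
    unfolding C1 by (simp add: upper_left_def)
  define F where "F = four_block_mat (1\<^sub>m a) X1 X2 X3"
  define G where "G = four_block_mat (1\<^sub>m b) Y1 Y2 Y3"
  have F: "F \<in> carrier_mat n m" and G: "G \<in> carrier_mat q p"
    unfolding F_def G_def using X Y le detW(1) detU(1) by auto
  \<comment> \<open>In \<open>A1 * C * B1\<close> the right hand side \<open>C\<close> occurs only between \<open>Q1\<close> and \<open>P2\<close>, where it has a single
    nonzero block.\<close>
  have "A1 * C * B1 = P1 * (F * (Q1 * C * P2) * G) * Q2"
    unfolding A1 B1 F_def[symmetric] G_def[symmetric] using nfA nfB F G C
    by (simp add: mult_assoc_dims)
  also have "F * (Q1 * C * P2)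
    = four_block_mat C1 (0\<^sub>m a (q - b)) (X2 * C1) (0\<^sub>m (n - a) (q - b))"
    unfolding core F_def
    by (subst mult_four_block_mat[of _ a a _ "m - a" _ "n - a" _ _ b _ "q - b"])
      (use X C1c in auto)
  also have "\<dots> * G = four_block_mat C1 (C1 * Y1) (X2 * C1) (X2 * C1 * Y1)"
    unfolding G_def
    by (subst mult_four_block_mat[of _ a b _ "q - b" _ "n - a" _ _ b _ "p - b"])
      (use X Y C1c in auto)
  finally have "A1 * C * B1
    = P1 * four_block_mat C1 (C1 * Y1) (X2 * C1) (X2 * C1 * Y1) * Q2" .
  with inverses general_and_reproductive_solution[OF A(1) B(1) S X0 inverses g]
  show ?thesis by simp
qed

end
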